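(* Let $n\ge 1$, $N\in\mathbb{N}$, $S>0$, and let $\phi_\lambda:\mathbb{D}^n(S)\to\mathbb{C}$ be an analytic function over $\mathbb{D}^n(S)$ with Taylor expansion $\phi_\lambda(x)=\sum_{k\in\mathbb{N}_0^n}c_k x^k$. Assume that its Taylor coefficients satisfy $$\max_{|k|>N}|c_k|\,S^{|k|}<M_1(N)$$ for some $M_1(N)\in\mathbb{R}^+$. Then, for every $R$ with $0<R<S$ and every $x\in\mathbb{D}^n(R)$, $$|\phi_\lambda(x)-(P_N\phi_\lambda)(x)|<M_1(N)\left[\left(\frac{1}{1-R/S}\right)^n-\sum_{k=0}^{N}\binom{n+k-1}{k}\left(\frac{R}{S}\right)^{k}\right].$$
   Context: For $r>0$, $\mathbb{D}^n(r)=\{x\in\mathbb{R}^n : |x_i|<r \text{ for all } i\}$. For a multi-index $k=(k_1,\dots,k_n)\in\mathbb{N}_0^n$ (where $\mathbb{N}_0=\{0,1,2,\dots\}$ here), $|k|=k_1+\cdots+k_n$ and $x^k=x_1^{k_1}\cdots x_n^{k_n}$. "Analytic over $\mathbb{D}^n(S)$" means that the function is equal on $\mathbb{D}^n(S)$ to the sum of its (convergent) Taylor series at the origin, with coefficients $c_k\in\mathbb{C}$. $P_N$ is the truncation operator of the Taylor series at total degree $N$: $(P_N\phi_\lambda)(x)=\sum_{|k|\le N}c_kx^k$. (In the paper $\phi_\lambda$ is an eigenfunction of a Koopman generator, but the paper states that the result holds for any analytic function.) *)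

theory Defs
  imports "HOL-Analysis.Analysis"
begin

definition cube :: "real \<Rightarrow> (real ^ 'n) set" where
  "cube r = {x. \<forall>i. \<bar>x $ i\<bar> < r}"

type_synonym 'n multi_index = "'n \<Rightarrow> nat"

definition mdeg :: "('n::finite) multi_index \<Rightarrow> nat" where
  "mdeg k = (\<Sum>i\<in>UNIV. k i)"

definition mpow :: "real ^ 'n \<Rightarrow> ('n::finite) multi_index \<Rightarrow> real" where
  "mpow x k = (\<Prod>i\<in>UNIV. (x $ i) ^ k i)"

definition partial_deriv :: "'n \<Rightarrow> (real ^ 'n \<Rightarrow> complex) \<Rightarrow> real ^ 'n \<Rightarrow> complex" where
  "partial_deriv i f x = vector_derivative (\<lambda>t. f (x + t *\<^sub>R axis i 1)) (at 0)"

text \<open>The index type carries no order, so the order of the partial derivatives is fixed by an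
  arbitrary enumeration of it. For functions that are smooth near the point of evaluation the
  result does not depend on this choice.\<close>

definition mixed_partial ::
    "('n::finite) multi_index \<Rightarrow> (real ^ 'n \<Rightarrow> complex) \<Rightarrow> real ^ 'n \<Rightarrow> complex" where
  "mixed_partial k f =
     fold (\<lambda>i. partial_deriv i ^^ k i) (SOME is. set is = UNIV \<and> distinct is) f"

definition taylor_coeff :: "(real ^ 'n \<Rightarrow> complex) \<Rightarrow> ('n::finite) multi_index \<Rightarrow> complex" where
  "taylor_coeff f k = mixed_partial k f 0 / (\<Prod>i\<in>UNIV. fact (k i))"

text \<open>Convergence of the Taylor series is unordered (equivalently, absolute) summability over all
  multi-indices. No separate smoothness condition is needed: a function that equals a convergent
  power series on the cube is smooth there, with that series as its Taylor series.\<close>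

definition analytic_over_cube :: "(real ^ 'n \<Rightarrow> complex) \<Rightarrow> real \<Rightarrow> bool" where
  "analytic_over_cube f S \<longleftrightarrow>
     (\<forall>x\<in>cube S. ((\<lambda>k. taylor_coeff f k * of_real (mpow x k)) has_sum f x) UNIV)"

definition taylor_trunc :: "nat \<Rightarrow> (real ^ 'n \<Rightarrow> complex) \<Rightarrow> real ^ 'n \<Rightarrow> complex" where
  "taylor_trunc N f x = (\<Sum>k | mdeg k \<le> N. taylor_coeff f k * of_real (mpow x k))"

end

theory Submission
  imports Defs
begin

text \<open>Every term of the tail satisfies \<open>\<bar>c\<^sub>k x\<^sup>k\<bar> < M\<^sub>1 q\<^bsup>|k|\<^esup>\<close> with \<open>q = R / S\<close>, so the error is smaller than
  \<open>M\<^sub>1\<close> times the tail of the multivariate geometric series. The full series is the \<open>n\<close>-th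
  power of the univariate one, and its part of total degree \<open>j\<close> consists of as many equal terms
  as there are compositions of \<open>j\<close> into \<open>n\<close> nonnegative parts.\<close>

lemma prod_power_mdeg: "(\<Prod>i\<in>UNIV. q ^ k i) = (q :: 'a :: comm_monoid_mult) ^ mdeg k"
  unfolding mdeg_def by (simp add: power_sum)

text \<open>Stars and bars: listing the values of \<open>k\<close> along a fixed enumeration
  \<open>es\<close> of the index type turns multi-indices into lists of naturals of length
  \<open>CARD('n)\<close> with sum \<open>j\<close>, for which \<open>card_length_sum_list\<close>
  gives the count.\<close>

lemma card_mdeg_eq:
  "card {k :: ('n::finite) multi_index. mdeg k = j} = (CARD('n) + j - 1) choose j"
proof -
  obtain es :: "'n list" where es: "set es = UNIV" "distinct es"
    using finite_distinct_list[OF finite[of UNIV]] by blast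
  have len: "length es = CARD('n)"
    using es distinct_card by fastforce
  have sum: "sum_list (map k es) = mdeg k" for k :: "'n multi_index"
    unfolding mdeg_def using es by (simp add: sum_list_distinct_conv_sum_set)
  have "bij_betw (\<lambda>k. map k es) {k :: 'n multi_index. mdeg k = j}
          {l. length l = CARD('n) \<and> sum_list l = j}"
    unfolding bij_betw_def
  proof
    show "inj_on (\<lambda>k. map k es) {k :: 'n multi_index. mdeg k = j}"
      using es by (auto simp: inj_on_def fun_eq_iff)
    show "(\<lambda>k. map k es) ` {k. mdeg k = j} = {l. length l = CARD('n) \<and> sum_list l = j}"
    proof (intro equalityI subsetI)
      fix l assume "l \<in> (\<lambda>k. map k es) ` {k. mdeg k = j}"
      then show "l \<in> {l. length l = CARD('n) \<and> sum_list l = j}"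
        using sum len by auto
    next
      fix l :: "nat list" assume l: "l \<in> {l. length l = CARD('n) \<and> sum_list l = j}"
      \<comment> \<open>The preimage of \<open>l\<close> gives each index the entry of
        \<open>l\<close> at its position in \<open>es\<close>; \<open>the\<close> is harmless
        because \<open>es\<close> covers the whole type.\<close>
      define k where "k = (\<lambda>i. the (map_of (zip es l) i))"
      have "map k es = l"
        unfolding k_def using es l len
        by (intro nth_equalityI) (auto simp: map_of_zip_nth)
      then show "l \<in> (\<lambda>k. map k es) ` {k. mdeg k = j}"
        using l sum[of k] by auto
    qed
  qed
  then show ?thesis
    by (simp add: bij_betw_same_card card_length_sum_list add.commute)
qed

lemma finite_mdeg_le: "finite {k :: ('n::finite) multi_index. mdeg k \<le> N}"
proof (rule finite_subset)
  show "{k :: 'n multi_index. mdeg k \<le> N} \<subseteq> (UNIV \<rightarrow>\<^sub>E {..N})"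
  proof
    fix k :: "'n multi_index" assume "k \<in> {k. mdeg k \<le> N}"
    moreover have "k i \<le> mdeg k" for i
      unfolding mdeg_def by (rule member_le_sum) auto
    ultimately show "k \<in> UNIV \<rightarrow>\<^sub>E {..N}"
      by (auto intro: order_trans)
  qed
  show "finite ((UNIV :: 'n set) \<rightarrow>\<^sub>E {..N})"
    by (intro finite_PiE) auto
qed

text \<open>The summand is constant on each degree class, so grouping by degree leaves only the
  class sizes from \<open>card_mdeg_eq\<close>.\<close>

lemma sum_power_mdeg_le:
  "(\<Sum>k :: ('n::finite) multi_index | mdeg k \<le> N. (q :: real) ^ mdeg k)
    = (\<Sum>j=0..N. real ((CARD('n) + j - 1) choose j) * q ^ j)"
proof -
  have "(\<Sum>k :: 'n multi_index | mdeg k \<le> N. q ^ mdeg k)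
      = (\<Sum>j=0..N. \<Sum>k :: 'n multi_index | k \<in> {k. mdeg k \<le> N} \<and> mdeg k = j. q ^ mdeg k)"
    by (rule sum.group[symmetric]) (auto simp: finite_mdeg_le)
  also have "\<dots> = (\<Sum>j=0..N. \<Sum>k :: 'n multi_index | mdeg k = j. q ^ j)"
    by (intro sum.cong) auto
  finally show ?thesis
    by (simp add: card_mdeg_eq)
qed

text \<open>Absolute convergence allows the product of \<open>CARD('n)\<close> copies of the
  geometric series to be expanded over all choices of one exponent per index, that is, over all
  multi-indices.\<close>

lemma has_sum_power_mdeg:
  fixes q :: real
  assumes "0 \<le> q" "q < 1"
  shows "((\<lambda>k :: ('n::finite) multi_index. q ^ mdeg k) has_sum (1 / (1 - q)) ^ CARD('n)) UNIV"
proof -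
  have geom: "((\<lambda>j. q ^ j) has_sum 1 / (1 - q)) UNIV"
    using assms by (intro sums_nonneg_imp_has_sum geometric_sums) auto
  then have "(\<lambda>j. norm (q ^ j)) summable_on UNIV"
    using assms by (auto simp: summable_on_def)
  then have "(\<Sum>\<^sub>\<infinity>k :: 'n multi_index \<in> UNIV \<rightarrow>\<^sub>E UNIV. \<Prod>i\<in>UNIV. q ^ k i)
      = (\<Prod>i\<in>(UNIV :: 'n set). \<Sum>\<^sub>\<infinity>j. q ^ j)"
    by (intro infsum_prod_PiE_abs) auto
  then have eq: "(\<Sum>\<^sub>\<infinity>k :: 'n multi_index. q ^ mdeg k) = (1 / (1 - q)) ^ CARD('n)"
    using infsumI[OF geom] by (simp add: prod_power_mdeg)
  \<comment> \<open>\<open>infsum\<close> defaults to 0 on families that are not summable, so a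
    nonzero value proves summability.\<close>
  also have "\<dots> \<noteq> 0"
    using assms by simp
  finally have "(\<lambda>k :: 'n multi_index. q ^ mdeg k) summable_on UNIV"
    using infsum_not_exists by blast
  then show ?thesis
    using eq by (metis has_sum_infsum)
qed

lemma abs_mpow_le:
  assumes "x \<in> cube R"
  shows "\<bar>mpow x k\<bar> \<le> R ^ mdeg k"
proof -
  have "\<bar>mpow x k\<bar> \<le> (\<Prod>i\<in>UNIV. R ^ k i)"
    unfolding mpow_def abs_prod using assms
    by (intro prod_mono) (auto simp: power_abs cube_def less_imp_le intro!: power_mono)
  then show ?thesis
    by (simp add: prod_power_mdeg)
qed

theorem proposition2:
  fixes \<phi> :: "real ^ 'n \<Rightarrow> complex"
    and N :: nat
    and S R M\<^sub>1 :: real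
    and x :: "real ^ 'n"
  assumes "S > 0"
    and "analytic_over_cube \<phi> S"
    and "M\<^sub>1 > 0"
    and "(SUP k\<in>{k. mdeg k > N}. ereal (cmod (taylor_coeff \<phi> k) * S ^ mdeg k)) < ereal M\<^sub>1"
    and "0 < R" and "R < S"
    and "x \<in> cube R"
  shows "cmod (\<phi> x - taylor_trunc N \<phi> x)
    < M\<^sub>1 * ((1 / (1 - R / S)) ^ CARD('n)
        - (\<Sum>k=0..N. real ((CARD('n) + k - 1) choose k) * (R / S) ^ k))"
proof -
  define c where "c = taylor_coeff \<phi>"
  define f where "f = (\<lambda>k. c k * of_real (mpow x k))"
  define q where "q = R / S"
  have q: "0 < q" "q < 1"
    using assms by (auto simp: q_def)
  let ?L = "{k :: 'n multi_index. mdeg k \<le> N}"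
  let ?T = "- ?L"
  have "x \<in> cube S"
    using assms(6,7) unfolding cube_def by (auto intro: less_trans)
  then have "(f has_sum \<phi> x) UNIV"
    using assms(2) by (simp add: analytic_over_cube_def f_def c_def)
  moreover have "(f has_sum taylor_trunc N \<phi> x) ?L"
    by (rule has_sum_finiteI) (auto simp: finite_mdeg_le taylor_trunc_def f_def c_def)
  ultimately have f_tail: "(f has_sum (\<phi> x - taylor_trunc N \<phi> x)) ?T"
    unfolding Compl_eq_Diff_UNIV by (intro has_sum_Diff) auto
  have "((\<lambda>k :: 'n multi_index. q ^ mdeg k) has_sum
      (\<Sum>j=0..N. real ((CARD('n) + j - 1) choose j) * q ^ j)) ?L"
    by (rule has_sum_finiteI) (auto simp: finite_mdeg_le sum_power_mdeg_le)
  then have q_tail: "((\<lambda>k :: 'n multi_index. M\<^sub>1 * q ^ mdeg k) has_sum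
      M\<^sub>1 * ((1 / (1 - q)) ^ CARD('n)
        - (\<Sum>j=0..N. real ((CARD('n) + j - 1) choose j) * q ^ j))) ?T"
    unfolding Compl_eq_Diff_UNIV using q
    by (intro has_sum_cmult_right has_sum_Diff has_sum_power_mdeg) auto
  have less: "norm (f k) < M\<^sub>1 * q ^ mdeg k" if "k \<in> ?T" for k
  proof -
    \<comment> \<open>Suprema in \<open>ereal\<close> always exist, so no boundedness has to be
      shown before comparing a term with the supremum.\<close>
    have "ereal (cmod (c k) * S ^ mdeg k)
        \<le> (SUP k\<in>{k. mdeg k > N}. ereal (cmod (taylor_coeff \<phi> k) * S ^ mdeg k))"
      unfolding c_def using that by (intro SUP_upper) auto
    then have "cmod (c k) * S ^ mdeg k < M\<^sub>1"
      using assms(4) by (auto dest: le_less_trans)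
    moreover have "norm (f k) \<le> cmod (c k) * R ^ mdeg k"
      unfolding f_def norm_mult using abs_mpow_le[OF assms(7)] by (simp add: mult_left_mono)
    moreover have "cmod (c k) * R ^ mdeg k = cmod (c k) * S ^ mdeg k * q ^ mdeg k"
      using assms(1) by (simp add: q_def power_divide)
    ultimately show ?thesis
      using q by (smt (verit) mult_strict_right_mono zero_less_power)
  qed
  \<comment> \<open>For complex families, unordered summability already implies absolute
    summability.\<close>
  have "(\<lambda>k. norm (f k)) summable_on ?T"
    using f_tail by (metis has_sum_imp_summable summable_on_iff_abs_summable_on_complex)
  then obtain s where s: "((\<lambda>k. norm (f k)) has_sum s) ?T"
    by (auto simp: summable_on_def)
  have "cmod (\<phi> x - taylor_trunc N \<phi> x) \<le> s"
    using norm_infsum_le[OF f_tail s] by simp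
  \<comment> \<open>Termwise strictness passes to the sums only if the tail has an element. This
    constant multi-index has degree \<open>CARD('n) * Suc N\<close>, which exceeds \<open>N\<close>
    because \<open>CARD('n)\<close> is positive.\<close>
  also have "(\<lambda>_. Suc N) \<in> ?T"
    by (simp add: mdeg_def not_le trans_less_add1 flip: Suc_le_eq del: mult_Suc_right)
  then have "s < M\<^sub>1 * ((1 / (1 - q)) ^ CARD('n)
      - (\<Sum>j=0..N. real ((CARD('n) + j - 1) choose j) * q ^ j))"
    using has_sum_strict_mono[OF s q_tail] less by (meson less_imp_le)
  finally show ?thesis
    by (simp add: q_def)
qed

end
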